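(* Consider $\min_{\mathbf{x}\in\mathbb{R}^d}F(\mathbf{x})=f(\mathbf{x})+r(\mathbf{x})$ with $f(\mathbf{x})=\mathbb{E}_\xi[f(\mathbf{x};\xi)]$, where $r:\mathbb{R}^d\to\mathbb{R}\cup\{+\infty\}$ is proper and lower-semicontinuous (possibly non-smooth, non-convex). Assume: (i) $\mathbb{E}_\xi[\nabla f(\mathbf{x};\xi)]=\nabla f(\mathbf{x})$ and $\mathbb{E}_\xi[\|\nabla f(\mathbf{x};\xi)-\nabla f(\mathbf{x})\|^2]\le\sigma^2$ for all $\mathbf{x}$, for some $\sigma>0$; (ii) $F(\mathbf{x}_0)-F(\mathbf{x}_* )\le\Delta<\infty$ for the initial point $\mathbf{x}_0$, where $\mathbf{x}_*$ is a global minimizer of $F$; (iii) $f$ is differentiable and $\|\nabla f(\mathbf{x})-\nabla f(\mathbf{y})\|\le L\|\mathbf{x}-\mathbf{y}\|$ for all $\mathbf{x},\mathbf{y}$, for some $L>0$. Let $\eta=\frac{c}{L}$ with $0<c<\frac12$, and assume $\mathrm{prox}_{\eta r}[\mathbf{x}]\ne\emptyset$ for every $\mathbf{x}$. Then for every $T\ge1$ and every choice of mini-batch sizes $m_0,\dots,m_{T-1}\ge1$, the output $\mathbf{x}_R$ of algorithm MB-SPG (defined in the context) satisfies $$\mathbb{E}\big[\mathrm{dist}(0,\hat\partial F(\mathbf{x}_R))^2\big]\le\frac{c_1}{T}\sum_{t=0}^{T-1}\mathbb{E}\big[\|\mathbf{g}_t-\nabla f(\mathbf{x}_t)\|^2\big]+\frac{c_2\Delta}{\eta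 T},$$ where $c_1=\frac{2c(1-2c)+2}{c(1-2c)}$ and $c_2=\frac{6-4c}{1-2c}$.
   Context: Algorithm MB-SPG (mini-batch stochastic proximal gradient): starting from $\mathbf{x}_0$, for $t=0,\dots,T-1$ draw $m_t$ fresh i.i.d. samples $\xi_1,\dots,\xi_{m_t}$ of $\xi$, independent of the past, set $\mathbf{g}_t=\frac{1}{m_t}\sum_{i=1}^{m_t}\nabla f(\mathbf{x}_t;\xi_i)$, and choose $\mathbf{x}_{t+1}\in\mathrm{prox}_{\eta r}[\mathbf{x}_t-\eta\mathbf{g}_t]$ (the iterates being random variables). Output $\mathbf{x}_R$ with $R$ uniform on $\{1,\dots,T\}$, independent of everything else. $\|\cdot\|$ is the Euclidean norm; $\mathrm{prox}_{\eta r}[\mathbf{x}]=\arg\min_{\mathbf{y}\in\mathbb{R}^d}\frac{1}{2\eta}\|\mathbf{y}-\mathbf{x}\|^2+r(\mathbf{y})$ (set of minimizers). For $h:\mathbb{R}^d\to\mathbb{R}\cup\{+\infty\}$ and $\bar{\mathbf{x}}$ with $h(\bar{\mathbf{x}})$ finite, the Fréchet subgradient set is $\hat\partial h(\bar{\mathbf{x}})=\{\mathbf{v}\in\mathbb{R}^d:\liminf_{\mathbf{x}\to\bar{\mathbf{x}},\,\mathbf{x}\ne\bar{\mathbf{x}}}\frac{h(\mathbf{x})-h(\bar{\mathbf{x}})-\mathbf{v}^\top(\mathbf{x}-\bar{\mathbf{x}})}{\|\mathbf{x}-\bar{\mathbf{x}}\|}\ge0\}$. $\mathrm{dist}(0,S)=\inf_{\mathbf{v}\in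 S}\|\mathbf{v}\|$ (and $+\infty$ if $S=\emptyset$). *)

theory Defs
  imports "HOL-Probability.Probability"
begin

definition proper_fun :: "('a \<Rightarrow> ereal) \<Rightarrow> bool" where
  "proper_fun h \<longleftrightarrow> (\<forall>x. h x \<noteq> -\<infinity>) \<and> (\<exists>x. h x \<noteq> \<infinity>)"

definition lsc_fun :: "('a::topological_space \<Rightarrow> ereal) \<Rightarrow> bool" where
  "lsc_fun h \<longleftrightarrow> (\<forall>x. h x \<le> Liminf (at x) h)"

definition prox :: "real \<Rightarrow> ('a::real_normed_vector \<Rightarrow> ereal) \<Rightarrow> 'a \<Rightarrow> 'a set" where
  "prox \<eta> r x =
     {y. \<forall>z. ereal (1 / (2 * \<eta>) * (norm (y - x))\<^sup>2) + r y
            \<le> ereal (1 / (2 * \<eta>) * (norm (z - x))\<^sup>2) + r z}"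

(* The subgradient set is empty at points where h is not finite. *)
definition frechet_subdiff :: "('a::real_inner \<Rightarrow> ereal) \<Rightarrow> 'a \<Rightarrow> 'a set" where
  "frechet_subdiff h x =
     {v. \<bar>h x\<bar> \<noteq> \<infinity> \<and>
         0 \<le> Liminf (at x) (\<lambda>y. (h y - h x - ereal (v \<bullet> (y - x))) / ereal (norm (y - x)))}"

(* Unlike infdist, which is 0 on the empty set, this is \<infinity> there. *)
definition dist0 :: "'a::real_normed_vector set \<Rightarrow> ennreal" where
  "dist0 S = (INF v\<in>S. ennreal (norm v))"

definition minibatch_grad ::
  "('a::real_vector \<Rightarrow> 's \<Rightarrow> 'a) \<Rightarrow> (nat \<Rightarrow> nat) \<Rightarrow> (nat \<Rightarrow> nat \<Rightarrow> '\<omega> \<Rightarrow> 's) \<Rightarrow>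
   (nat \<Rightarrow> '\<omega> \<Rightarrow> 'a) \<Rightarrow> nat \<Rightarrow> '\<omega> \<Rightarrow> 'a" where
  "minibatch_grad gs m \<xi> X t \<omega> =
     (1 / real (m t)) *\<^sub>R (\<Sum>i<m t. gs (X t \<omega>) (\<xi> t i \<omega>))"

(* Everything generated before the samples of iteration t are drawn: the iterates X 0, ..., X t
   and the samples of the iterations before t, as one random variable. *)
definition history ::
  "(nat \<Rightarrow> nat) \<Rightarrow> (nat \<Rightarrow> nat \<Rightarrow> '\<omega> \<Rightarrow> 's) \<Rightarrow> (nat \<Rightarrow> '\<omega> \<Rightarrow> 'a) \<Rightarrow> nat \<Rightarrow> '\<omega> \<Rightarrow>
   (nat \<Rightarrow> 'a) \<times> (nat \<times> nat \<Rightarrow> 's)" where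
  "history m \<xi> X t \<omega> =
     (\<lambda>s\<in>{..t}. X s \<omega>, \<lambda>p\<in>(SIGMA s:{..<t}. {..<m s}). \<xi> (fst p) (snd p) \<omega>)"

definition history_space ::
  "'s measure \<Rightarrow> (nat \<Rightarrow> nat) \<Rightarrow> nat \<Rightarrow>
   ((nat \<Rightarrow> 'a::topological_space) \<times> (nat \<times> nat \<Rightarrow> 's)) measure" where
  "history_space D m t =
     (\<Pi>\<^sub>M s\<in>{..t}. borel) \<Otimes>\<^sub>M (\<Pi>\<^sub>M p\<in>(SIGMA s:{..<t}. {..<m s}). D)"

(* prob_space.indep_var needs both variables to have the same value type, hence this heterogeneous
   version: the sigma-algebras generated by Y and Z are independent. *)
definition indep_rvs ::
  "'\<omega> measure \<Rightarrow> 'b measure \<Rightarrow> ('\<omega> \<Rightarrow> 'b) \<Rightarrow> 'c measure \<Rightarrow> ('\<omega> \<Rightarrow> 'c) \<Rightarrow> bool" where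
  "indep_rvs M S Y N Z \<longleftrightarrow>
     Y \<in> M \<rightarrow>\<^sub>M S \<and> Z \<in> M \<rightarrow>\<^sub>M N \<and>
     prob_space.indep_set M {Y -` A \<inter> space M |A. A \<in> sets S} {Z -` B \<inter> space M |B. B \<in> sets N}"

(* M is the probability space of the run, D the law of a sample.  The choice of X (Suc t) in the
   proximal set is unrestricted (it may use extra randomness), except that later samples must be
   independent of the iterates chosen so far. *)
definition mb_spg ::
  "'\<omega> measure \<Rightarrow> 's measure \<Rightarrow> ('a::euclidean_space \<Rightarrow> 's \<Rightarrow> 'a) \<Rightarrow> ('a \<Rightarrow> ereal) \<Rightarrow> real \<Rightarrow>
   nat \<Rightarrow> (nat \<Rightarrow> nat) \<Rightarrow> 'a \<Rightarrow> (nat \<Rightarrow> nat \<Rightarrow> '\<omega> \<Rightarrow> 's) \<Rightarrow> (nat \<Rightarrow> '\<omega> \<Rightarrow> 'a) \<Rightarrow> ('\<omega> \<Rightarrow> nat) \<Rightarrow> bool"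
where
  "mb_spg M D gs r \<eta> T m x0 \<xi> X R \<longleftrightarrow>
     prob_space M \<and>
     (\<forall>t\<le>T. X t \<in> borel_measurable M) \<and>
     (\<forall>\<omega>\<in>space M. X 0 \<omega> = x0) \<and>
     (\<forall>t<T.
        (\<forall>i<m t. \<xi> t i \<in> M \<rightarrow>\<^sub>M D \<and> distr M D (\<xi> t i) = D) \<and>
        prob_space.indep_vars M (\<lambda>_. D) (\<xi> t) {..<m t} \<and>
        indep_rvs M
          (\<Pi>\<^sub>M i\<in>{..<m t}. D) (\<lambda>\<omega>. \<lambda>i\<in>{..<m t}. \<xi> t i \<omega>)
          (history_space D m t) (history m \<xi> X t) \<and>
        (\<forall>\<omega>\<in>space M.
           X (Suc t) \<omega> \<in> prox \<eta> r (X t \<omega> - \<eta> *\<^sub>R minibatch_grad gs m \<xi> X t \<omega>))) \<and>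
     R \<in> M \<rightarrow>\<^sub>M count_space UNIV \<and>
     distr M (count_space UNIV) R = measure_pmf (pmf_of_set {1..T}) \<and>
     indep_rvs M (count_space UNIV) R (history_space D m T) (history m \<xi> X T)"

end

theory Submission
  imports Defs
begin

text \<open>
  Fermat's rule for the proximal step puts
  \<open>v = gf x' - g - (x' - x) / \<eta>\<close> into the subgradient set at the new iterate \<open>x'\<close>.
  Expanding the square of \<open>v\<close> produces the inner product of the gradient error with the step,
  which the optimality of \<open>x'\<close> against \<open>x\<close> and the smoothness of \<open>f\<close> bound by the decrease of
  \<open>F\<close>; the same inequality and AM-GM control the squared step length.  This gives, for every
  outcome, a bound by \<open>c1\<close> times the squared gradient error plus \<open>c2 / \<eta>\<close> times the decrease
  of \<open>F\<close>, and the decreases telescope.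

  The distance to the subgradient set need not be known to be measurable: it is first replaced by
  the norm of \<open>v\<close>, a measurable function of the history, and only then is the independence of \<open>R\<close>
  used.
\<close>

section \<open>Quadratic bounds from a Lipschitz gradient\<close>

lemma GDERIV_imp_DERIV_line:
  assumes "GDERIV f (x + t *\<^sub>R d) :> D"
  shows "DERIV (\<lambda>t. f (x + t *\<^sub>R d)) t :> D \<bullet> d"
proof -
  have line: "((\<lambda>t. x + t *\<^sub>R d) has_derivative (\<lambda>h. h *\<^sub>R d)) (at t)"
    by (auto intro!: derivative_eq_intros)
  have "(f has_derivative (\<lambda>h. h \<bullet> D)) (at (x + t *\<^sub>R d))"
    using assms by (simp add: gderiv_def)
  from has_derivative_compose[OF line this] show ?thesis
    by (simp add: has_field_derivative_def mult_commute_abs inner_commute)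
qed

text \<open>Subtracting the tangent and the quadratic term from \<open>f\<close> along the segment
  from \<open>y\<close> to \<open>z\<close> leaves a function \<open>\<phi>\<close> whose derivative
  is nonpositive on [0, 1], by Cauchy-Schwarz and the Lipschitz bound. Comparing its values at 0 and
  1 replaces integration of the gradient.\<close>

lemma smooth_upper_bound:
  fixes f :: "'a::real_inner \<Rightarrow> real"
  assumes grad: "\<And>x. GDERIV f x :> g x"
    and lip: "\<And>x y. norm (g x - g y) \<le> L * norm (x - y)"
  shows "f z - f y - g y \<bullet> (z - y) \<le> L / 2 * (norm (z - y))\<^sup>2"
proof -
  define d where "d = z - y"
  define \<phi> where "\<phi> t = f (y + t *\<^sub>R d) - t * (g y \<bullet> d) - L / 2 * t\<^sup>2 * (norm d)\<^sup>2" for t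
  have deriv: "DERIV \<phi> t :> g (y + t *\<^sub>R d) \<bullet> d - g y \<bullet> d - L * t * (norm d)\<^sup>2" for t
  proof -
    have "DERIV (\<lambda>t. f (y + t *\<^sub>R d)) t :> g (y + t *\<^sub>R d) \<bullet> d"
      by (rule GDERIV_imp_DERIV_line[OF grad])
    then show ?thesis
      unfolding \<phi>_def by (auto intro!: derivative_eq_intros)
  qed
  have "\<phi> 1 \<le> \<phi> 0"
  proof (rule DERIV_nonpos_imp_nonincreasing[of 0 1 \<phi>])
    fix t :: real
    assume "0 \<le> t"
    have "g (y + t *\<^sub>R d) \<bullet> d - g y \<bullet> d = (g (y + t *\<^sub>R d) - g y) \<bullet> d"
      by (simp add: inner_diff_left)
    also have "\<dots> \<le> norm (g (y + t *\<^sub>R d) - g y) * norm d"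
      by (rule norm_cauchy_schwarz)
    also have "\<dots> \<le> (L * norm (t *\<^sub>R d)) * norm d"
      using lip[of "y + t *\<^sub>R d" y] by (intro mult_right_mono) auto
    finally show "\<exists>D. DERIV \<phi> t :> D \<and> D \<le> 0"
      using deriv[of t] \<open>0 \<le> t\<close> by (auto simp: power2_eq_square algebra_simps)
  qed simp
  then show ?thesis
    by (simp add: \<phi>_def d_def)
qed

text \<open>Negating \<open>f\<close> keeps the Lipschitz constant of the gradient. This half serves
  Fermat's rule, the upper bound serves the descent.\<close>

lemma smooth_lower_bound:
  fixes f :: "'a::real_inner \<Rightarrow> real"
  assumes grad: "\<And>x. GDERIV f x :> g x"
    and lip: "\<And>x y. norm (g x - g y) \<le> L * norm (x - y)"
  shows "- (L / 2 * (norm (z - y))\<^sup>2) \<le> f z - f y - g y \<bullet> (z - y)"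
proof -
  have "norm (- g x - - g y) \<le> L * norm (x - y)" for x y
    using lip[of x y] by (simp add: norm_minus_commute)
  from smooth_upper_bound[of "\<lambda>x. - f x" "\<lambda>x. - g x", OF GDERIV_minus[OF grad] this]
  have "- f z - - f y - - g y \<bullet> (z - y) \<le> L / 2 * (norm (z - y))\<^sup>2" .
  then show ?thesis
    by simp
qed

section \<open>Proximal points and Fermat's rule\<close>

lemma prox_finite:
  assumes "proper_fun r" "y \<in> prox \<eta> r p"
  shows "\<bar>r y\<bar> \<noteq> \<infinity>"
proof -
  obtain z where z: "r z \<noteq> \<infinity>"
    using assms by (auto simp: proper_fun_def)
  have "ereal (1 / (2 * \<eta>) * (norm (y - p))\<^sup>2) + r y \<le> ereal (1 / (2 * \<eta>) * (norm (z - p))\<^sup>2) + r z"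
    using assms by (auto simp: prox_def)
  moreover have "r z \<noteq> -\<infinity>" "r y \<noteq> -\<infinity>"
    using assms by (auto simp: proper_fun_def)
  ultimately show ?thesis
    using z by (cases "r y"; cases "r z") auto
qed

text \<open>Expanding the square of \<open>norm (z - p)\<close> around \<open>y\<close> turns
  minimality into a lower quadratic estimate of \<open>r\<close> at \<open>y\<close>. Arbitrary
  \<open>z\<close> will give a subgradient, the previous iterate will give descent.\<close>

lemma prox_ineq:
  fixes y p z :: "'a::real_inner"
  assumes "proper_fun r" "y \<in> prox \<eta> r p" "r z \<noteq> \<infinity>"
  shows "real_of_ereal (r y) \<le> real_of_ereal (r z) + 1 / \<eta> * ((y - p) \<bullet> (z - y))
    + 1 / (2 * \<eta>) * (norm (z - y))\<^sup>2"
proof -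
  have "r z \<noteq> -\<infinity>"
    using assms by (auto simp: proper_fun_def)
  then obtain b where b: "r z = ereal b"
    using assms by (cases "r z") auto
  obtain a where a: "r y = ereal a"
    using prox_finite[OF assms(1,2)] by (cases "r y") auto
  have "ereal (1 / (2 * \<eta>) * (norm (y - p))\<^sup>2) + r y \<le> ereal (1 / (2 * \<eta>) * (norm (z - p))\<^sup>2) + r z"
    using assms by (auto simp: prox_def)
  then have "1 / (2 * \<eta>) * (norm (y - p))\<^sup>2 + a \<le> 1 / (2 * \<eta>) * (norm (z - p))\<^sup>2 + b"
    by (simp add: a b)
  moreover have "(norm (z - p))\<^sup>2 = (norm (y - p))\<^sup>2 + 2 * ((y - p) \<bullet> (z - y)) + (norm (z - y))\<^sup>2"
    by (simp add: power2_norm_eq_inner inner_diff_left inner_diff_right inner_commute)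
  ultimately show ?thesis
    by (simp add: a b algebra_simps add_divide_distrib)
qed

text \<open>Near \<open>y\<close>, each of \<open>r\<close> and \<open>f\<close> is bounded below by
  its value at \<open>y\<close> plus a linear term minus a multiple of the squared distance. So the
  difference quotient of \<open>F\<close> is at least \<open>- K * norm (z - y)\<close>, which tends
  to 0. This direct estimate stands in for a sum rule for subgradients.\<close>

lemma prox_frechet_subdiff:
  fixes f :: "'a::real_inner \<Rightarrow> real"
  assumes grad: "\<And>x. GDERIV f x :> g x"
    and lip: "\<And>x y. norm (g x - g y) \<le> L * norm (x - y)"
    and F: "\<And>x. F x = ereal (f x) + r x"
    and proper: "proper_fun r"
    and y: "y \<in> prox \<eta> r p"
  shows "g y - (1 / \<eta>) *\<^sub>R (y - p) \<in> frechet_subdiff F y"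
proof -
  define v where "v = g y - (1 / \<eta>) *\<^sub>R (y - p)"
  define K where "K = L / 2 + 1 / (2 * \<eta>)"
  obtain a where a: "r y = ereal a"
    using prox_finite[OF proper y] by (cases "r y") auto
  have bound: "ereal (- K * norm (z - y)) \<le> (F z - F y - ereal (v \<bullet> (z - y))) / ereal (norm (z - y))"
    if "z \<noteq> y" for z
  proof (cases "r z = \<infinity>")
    case True
    then show ?thesis
      using that by (simp add: F a)
  next
    case False
    moreover have "r z \<noteq> -\<infinity>"
      using proper by (auto simp: proper_fun_def)
    ultimately obtain b where b: "r z = ereal b"
      by (cases "r z") auto
    have "a \<le> b + 1 / \<eta> * ((y - p) \<bullet> (z - y)) + 1 / (2 * \<eta>) * (norm (z - y))\<^sup>2"
      using prox_ineq[OF proper y False] by (simp add: a b)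
    moreover have "- (L / 2 * (norm (z - y))\<^sup>2) \<le> f z - f y - g y \<bullet> (z - y)"
      using smooth_lower_bound[OF grad lip] .
    moreover have "v \<bullet> (z - y) = g y \<bullet> (z - y) - 1 / \<eta> * ((y - p) \<bullet> (z - y))"
      by (simp add: v_def inner_diff_left)
    ultimately have "- K * (norm (z - y))\<^sup>2 \<le> (f z + b) - (f y + a) - v \<bullet> (z - y)"
      by (simp add: K_def algebra_simps)
    then have "- K * norm (z - y) \<le> ((f z + b) - (f y + a) - v \<bullet> (z - y)) / norm (z - y)"
      using that by (simp add: pos_le_divide_eq power2_eq_square mult.assoc)
    then show ?thesis
      using that by (simp add: F a b)
  qed
  have "((\<lambda>z. - K * norm (z - y)) \<longlongrightarrow> - K * norm (y - y)) (at y)"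
    by (intro tendsto_intros)
  then have lim: "((\<lambda>z. ereal (- K * norm (z - y))) \<longlongrightarrow> 0) (at y)"
    unfolding zero_ereal_def by (subst lim_ereal) simp
  have "0 \<le> Liminf (at y) (\<lambda>z. (F z - F y - ereal (v \<bullet> (z - y))) / ereal (norm (z - y)))"
  \<comment> \<open>The filter \<open>at y\<close> is trivial only in the zero space; there
    \<open>Liminf\<close> is the top element.\<close>
  proof (cases "at y = bot")
    case False
    have "0 = Liminf (at y) (\<lambda>z. ereal (- K * norm (z - y)))"
      using lim_imp_Liminf[OF False lim] by simp
    also have "\<dots> \<le> Liminf (at y) (\<lambda>z. (F z - F y - ereal (v \<bullet> (z - y))) / ereal (norm (z - y)))"
      using bound by (intro Liminf_mono) (auto simp: eventually_at_filter)
    finally show ?thesis .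
  qed simp
  then show ?thesis
    by (simp add: frechet_subdiff_def F a v_def)
qed

section \<open>The estimate for one iteration\<close>

text \<open>In the application \<open>d\<close> is the step, \<open>e\<close> the gradient error at
  the old point, \<open>a\<close> the change of the true gradient and \<open>\<delta>\<close> the
  decrease of \<open>F\<close>. After expanding the square, the mixed terms are absorbed into
  \<open>e \<bullet> e\<close>, \<open>u \<bullet> u\<close> and \<open>\<epsilon>\<close>; then
  \<open>u \<bullet> u\<close> is eliminated through the descent inequality.\<close>

lemma subgradient_norm_bound:
  fixes d e a :: "'a::real_inner"
  assumes c: "0 < c" "c < 1 / 2" and \<eta>: "\<eta> > 0"
    and a: "norm a \<le> c / \<eta> * norm d"
    and descent: "e \<bullet> d + (1 - c) / (2 * \<eta>) * (norm d)\<^sup>2 \<le> \<delta>"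
  shows "(norm (a - e - (1 / \<eta>) *\<^sub>R d))\<^sup>2
    \<le> (2 * c * (1 - 2 * c) + 2) / (c * (1 - 2 * c)) * (norm e)\<^sup>2
      + (6 - 4 * c) / (1 - 2 * c) / \<eta> * \<delta>"
proof -
  \<comment> \<open>These units remove \<open>\<eta>\<close> from the inequalities below;
    \<open>D\<close> is the descent hypothesis expressed in them.\<close>
  define u where "u = (1 / \<eta>) *\<^sub>R d"
  define \<epsilon> where "\<epsilon> = 2 * \<delta> / \<eta>"
  have d: "d = \<eta> *\<^sub>R u"
    using \<eta> by (simp add: u_def)
  have "norm a \<le> c * norm u"
    using a \<eta> by (simp add: d)
  then have "(norm a)\<^sup>2 \<le> (c * norm u)\<^sup>2" "norm a * norm u \<le> c * norm u * norm u"
    by (auto intro: power_mono mult_right_mono)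
  moreover have "- (a \<bullet> u) \<le> norm a * norm u"
    using Cauchy_Schwarz_ineq2[of a u] by linarith
  ultimately have A: "a \<bullet> a \<le> c\<^sup>2 * (u \<bullet> u)" and Q: "- (a \<bullet> u) \<le> c * (u \<bullet> u)"
    by (simp_all add: power_mult_distrib flip: power2_norm_eq_inner)
      (simp add: power2_eq_square mult.assoc)
  have S: "0 \<le> e \<bullet> e + 2 * (e \<bullet> a) + a \<bullet> a"
    using inner_ge_zero[of "e + a"] by (simp add: inner_add_left inner_add_right inner_commute)
  \<comment> \<open>AM-GM with weight \<open>c\<close>: divided by \<open>c\<close>, it bounds
    \<open>- 2 * (e \<bullet> u)\<close> by \<open>e \<bullet> e / c + c * (u \<bullet> u)\<close>.
    This lowers the coefficient \<open>1 - c\<close> in \<open>D\<close> to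
    \<open>1 - 2 * c\<close>, still positive because \<open>c < 1 / 2\<close>.\<close>
  have P: "0 \<le> e \<bullet> e + 2 * c * (e \<bullet> u) + c\<^sup>2 * (u \<bullet> u)"
    using inner_ge_zero[of "e + c *\<^sub>R u"]
    by (simp add: inner_add_left inner_add_right inner_commute power2_eq_square algebra_simps)
  have "(1 - c) / (2 * \<eta>) * (norm d)\<^sup>2 = \<eta> * ((1 - c) * (u \<bullet> u)) / 2"
    using \<eta> by (simp add: d power_mult_distrib power2_norm_eq_inner power2_eq_square[of \<eta>])
  moreover have "e \<bullet> d = \<eta> * (e \<bullet> u)" "\<eta> * \<epsilon> = 2 * \<delta>"
    using \<eta> by (simp_all add: d \<epsilon>_def)
  ultimately have "\<eta> * (2 * (e \<bullet> u) + (1 - c) * (u \<bullet> u)) \<le> \<eta> * \<epsilon>"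
    using descent unfolding distrib_left by linarith
  then have D: "2 * (e \<bullet> u) + (1 - c) * (u \<bullet> u) \<le> \<epsilon>"
    using \<eta> by simp
  have "0 \<le> e \<bullet> e / c + 2 * (e \<bullet> u) + c * (u \<bullet> u)"
  proof -
    have "0 \<le> (e \<bullet> e + 2 * c * (e \<bullet> u) + c\<^sup>2 * (u \<bullet> u)) / c"
      using P c by simp
    also have "\<dots> = e \<bullet> e / c + 2 * (e \<bullet> u) + c * (u \<bullet> u)"
      using c by (simp add: field_simps power2_eq_square)
    finally show ?thesis .
  qed
  with D have "(1 - 2 * c) * (u \<bullet> u) \<le> \<epsilon> + e \<bullet> e / c"
    by (simp add: algebra_simps)
  then have N: "u \<bullet> u \<le> (\<epsilon> + e \<bullet> e / c) / (1 - 2 * c)"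
    using c by (simp add: pos_le_divide_eq mult.commute)
  have "c * c \<le> 1 / 2 * (1 / 2)"
    using c by (intro mult_mono) auto
  \<comment> \<open>Equality would hold at \<open>c = 1 / 2\<close>; rounding up to 2 produces the
    stated constants.\<close>
  then have "2 * c\<^sup>2 + 3 * c \<le> 2"
    using c by (simp add: power2_eq_square)
  then have C: "(2 * c\<^sup>2 + 3 * c) * (u \<bullet> u) \<le> 2 * (u \<bullet> u)"
    by (intro mult_right_mono) auto
  have "(norm (a - e - u))\<^sup>2
      = a \<bullet> a + e \<bullet> e + u \<bullet> u - 2 * (e \<bullet> a) - 2 * (a \<bullet> u) + 2 * (e \<bullet> u)"
    by (simp add: power2_norm_eq_inner inner_diff_left inner_diff_right inner_commute)
  \<comment> \<open>\<open>S\<close> trades \<open>- 2 * (e \<bullet> a)\<close> for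
    \<open>e \<bullet> e + a \<bullet> a\<close>, \<open>A\<close> and \<open>Q\<close> bound the
    terms in \<open>a\<close>, and \<open>D\<close> replaces
    \<open>2 * (e \<bullet> u) + u \<bullet> u\<close> by
    \<open>\<epsilon> + c * (u \<bullet> u)\<close>.\<close>
  also have "\<dots> \<le> 2 * (e \<bullet> e) + (2 * c\<^sup>2 + 3 * c) * (u \<bullet> u) + \<epsilon>"
    using A Q S D by (simp add: algebra_simps)
  also have "\<dots> \<le> 2 * (e \<bullet> e) + 2 * ((\<epsilon> + e \<bullet> e / c) / (1 - 2 * c)) + \<epsilon>"
    using C N by linarith
  also have "\<dots> = (2 * c * (1 - 2 * c) + 2) / (c * (1 - 2 * c)) * (norm e)\<^sup>2
      + (6 - 4 * c) / (1 - 2 * c) / \<eta> * \<delta>"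
  proof -
    \<comment> \<open>With \<open>k\<close> as \<open>1 - 2 * c\<close> and \<open>x\<close> as
      \<open>\<delta> / \<eta>\<close>, \<open>\<epsilon>\<close> is \<open>2 * x\<close> and
      \<open>2 * k + 4\<close> is \<open>6 - 4 * c\<close>.\<close>
    have "2 * E + 2 * ((2 * x + E / c) / k) + 2 * x = (2 * c * k + 2) / (c * k) * E + (2 * k + 4) / k * x"
      if "k > 0" for E x k :: real
      using that c by (simp add: field_simps)
    from this[of "1 - 2 * c" "e \<bullet> e" "\<delta> / \<eta>"] show ?thesis
      using c by (simp add: \<epsilon>_def power2_norm_eq_inner)
  qed
  finally show ?thesis
    by (simp add: u_def)
qed

text \<open>Minimality of \<open>y\<close> against \<open>x\<close> gains
  \<open>1 / (2 * \<eta>)\<close> times the squared step, and smoothness with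
  \<open>L = c / \<eta>\<close> costs \<open>c / (2 * \<eta>)\<close> times it. The difference is
  the descent hypothesis of \<open>subgradient_norm_bound\<close>.\<close>

lemma prox_gradient_step:
  fixes f :: "'a::real_inner \<Rightarrow> real"
  assumes grad: "\<And>x. GDERIV f x :> g x"
    and lip: "\<And>x y. norm (g x - g y) \<le> L * norm (x - y)"
    and proper: "proper_fun r"
    and c: "0 < c" "c < 1 / 2" and L: "L > 0" and \<eta>: "\<eta> = c / L"
    and y: "y \<in> prox \<eta> r (x - \<eta> *\<^sub>R G)" and x: "r x \<noteq> \<infinity>"
  shows "(norm (g y - G - (1 / \<eta>) *\<^sub>R (y - x)))\<^sup>2
    \<le> (2 * c * (1 - 2 * c) + 2) / (c * (1 - 2 * c)) * (norm (G - g x))\<^sup>2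
      + (6 - 4 * c) / (1 - 2 * c) / \<eta> *
        (f x + real_of_ereal (r x) - (f y + real_of_ereal (r y)))"
proof -
  have \<eta>_pos: "\<eta> > 0" and L_eq: "L = c / \<eta>"
    using \<eta> c L by auto
  have "real_of_ereal (r y) \<le> real_of_ereal (r x) + 1 / \<eta> * ((y - (x - \<eta> *\<^sub>R G)) \<bullet> (x - y))
      + 1 / (2 * \<eta>) * (norm (x - y))\<^sup>2"
    using prox_ineq[OF proper y x] .
  \<comment> \<open>The squared step enters with \<open>- 1 / \<eta>\<close> from here and
    \<open>1 / (2 * \<eta>)\<close> from above, so \<open>- 1 / (2 * \<eta>)\<close>
    remains.\<close>
  also have "(y - (x - \<eta> *\<^sub>R G)) \<bullet> (x - y) = - (norm (y - x))\<^sup>2 - \<eta> * (G \<bullet> (y - x))"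
    by (simp add: power2_norm_eq_inner inner_diff_left inner_diff_right inner_add_left
        inner_add_right inner_commute algebra_simps)
  finally have "real_of_ereal (r y) + G \<bullet> (y - x) + 1 / (2 * \<eta>) * (norm (y - x))\<^sup>2
      \<le> real_of_ereal (r x)"
    using \<eta>_pos by (simp add: norm_minus_commute field_simps)
  moreover have "f y - f x - g x \<bullet> (y - x) \<le> L / 2 * (norm (y - x))\<^sup>2"
    using smooth_upper_bound[OF grad lip] .
  ultimately have "(G - g x) \<bullet> (y - x) + (1 - c) / (2 * \<eta>) * (norm (y - x))\<^sup>2
      \<le> f x + real_of_ereal (r x) - (f y + real_of_ereal (r y))"
    using \<eta>_pos by (simp add: L_eq inner_diff_left diff_divide_distrib algebra_simps)
  from subgradient_norm_bound[OF c \<eta>_pos _ this, of "g y - g x"]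
  show ?thesis
    using lip[of y x] by (simp add: L_eq)
qed

section \<open>Joint measurability of the sample gradients\<close>

text \<open>The first argument is approximated by simple functions \<open>q i\<close>. As these take
  finitely many values, \<open>u (q i x) s\<close> is assembled from measurable sections, and
  continuity in \<open>x\<close> gives convergence to \<open>u x s\<close>.\<close>

lemma borel_measurable_caratheodory:
  fixes u :: "'a::{metric_space, second_countable_topology} \<Rightarrow> 's \<Rightarrow> 'b::metric_space"
  assumes meas: "\<And>x. u x \<in> borel_measurable D"
    and cont: "\<And>s. s \<in> space D \<Longrightarrow> continuous_on UNIV (\<lambda>x. u x s)"
  shows "(\<lambda>p. u (fst p) (snd p)) \<in> borel_measurable (borel \<Otimes>\<^sub>M D)"
proof -
  have "(\<lambda>x::'a. x) \<in> borel_measurable borel"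
    by simp
  from borel_measurable_implies_sequence_metric[OF this]
  obtain q :: "nat \<Rightarrow> 'a \<Rightarrow> 'a" where q: "\<And>i. simple_function borel (q i)" "\<And>x. (\<lambda>i. q i x) \<longlonglongrightarrow> x"
    by (simp, blast)
  show ?thesis
  proof (rule borel_measurable_LIMSEQ_metric)
    fix i
    show "(\<lambda>p. u (q i (fst p)) (snd p)) \<in> borel_measurable (borel \<Otimes>\<^sub>M D)"
    proof (rule measurable_compose_countable'[where f = "\<lambda>x p. u x (snd p)"
          and g = "\<lambda>p. q i (fst p)" and I = "range (q i)"])
      show "countable (range (q i))"
        using q(1)[of i] by (auto simp: simple_function_def intro: countable_finite)
      have "q i \<in> borel \<rightarrow>\<^sub>M count_space (range (q i))"
        using q(1)[of i] measurable_simple_function[of borel "q i"]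
        by (intro measurable_count_space_extend[of "range (q i)" UNIV]) auto
      then show "(\<lambda>p. q i (fst p)) \<in> borel \<Otimes>\<^sub>M D \<rightarrow>\<^sub>M count_space (range (q i))"
        by (rule measurable_compose[OF measurable_fst])
    qed (rule measurable_compose[OF measurable_snd meas])
  next
    fix p :: "'a \<times> 's"
    assume "p \<in> space (borel \<Otimes>\<^sub>M D)"
    then have "continuous_on UNIV (\<lambda>x. u x (snd p))"
      by (intro cont) (auto simp: space_pair_measure)
    from continuous_on_tendsto_compose[OF this q(2)[of "fst p"]]
    show "(\<lambda>i. u (q i (fst p)) (snd p)) \<longlonglongrightarrow> u (fst p) (snd p)"
      by simp
  qed
qed

text \<open>Each coordinate of the gradient is a limit of difference quotients of \<open>u\<close>,
  which are jointly measurable by the previous lemma because differentiability gives continuity.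
  This makes a sample gradient at a random iterate a random variable.\<close>

lemma borel_measurable_gradient:
  fixes u :: "'a::euclidean_space \<Rightarrow> 's \<Rightarrow> real"
  assumes meas: "\<And>x. u x \<in> borel_measurable D"
    and grad: "\<And>x s. s \<in> space D \<Longrightarrow> GDERIV (\<lambda>y. u y s) x :> gu x s"
  shows "(\<lambda>p. gu (fst p) (snd p)) \<in> borel_measurable (borel \<Otimes>\<^sub>M D)"
proof (subst borel_measurable_euclidean_space, rule ballI)
  fix b :: 'a
  assume "b \<in> Basis"
  have "continuous_on UNIV (\<lambda>x. u x s)" if "s \<in> space D" for s
    using grad[OF that] by (auto simp: gderiv_def continuous_on_eq_continuous_at
        intro: has_derivative_continuous)
  note joint = borel_measurable_caratheodory[of u, OF meas this]
  show "(\<lambda>p. gu (fst p) (snd p) \<bullet> b) \<in> borel_measurable (borel \<Otimes>\<^sub>M D)"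
  proof (rule borel_measurable_LIMSEQ_real)
    fix n :: nat
    have "(\<lambda>p. u (fst p + (1 / real (Suc n)) *\<^sub>R b) (snd p)) \<in> borel_measurable (borel \<Otimes>\<^sub>M D)"
    proof -
      have "(\<lambda>p. (fst p + (1 / real (Suc n)) *\<^sub>R b, snd p)) \<in> borel \<Otimes>\<^sub>M D \<rightarrow>\<^sub>M borel \<Otimes>\<^sub>M D"
        by measurable
      from measurable_compose[OF this joint] show ?thesis
        by simp
    qed
    then show "(\<lambda>p. (u (fst p + (1 / real (Suc n)) *\<^sub>R b) (snd p) - u (fst p) (snd p)) / (1 / real (Suc n)))
        \<in> borel_measurable (borel \<Otimes>\<^sub>M D)"
      using joint by measurable
  next
    fix p :: "'a \<times> 's"
    assume "p \<in> space (borel \<Otimes>\<^sub>M D)"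
    then have s: "snd p \<in> space D"
      by (auto simp: space_pair_measure)
    have "DERIV (\<lambda>t. u (fst p + t *\<^sub>R b) (snd p)) 0 :> gu (fst p) (snd p) \<bullet> b"
      using GDERIV_imp_DERIV_line[of "\<lambda>x. u x (snd p)" "fst p" 0 b] grad[OF s] by simp
    then have "((\<lambda>h. (u (fst p + h *\<^sub>R b) (snd p) - u (fst p) (snd p)) / h)
        \<longlongrightarrow> gu (fst p) (snd p) \<bullet> b) (at 0)"
      by (simp add: DERIV_def)
    \<comment> \<open>The increments are nonzero, as the punctured filter \<open>at 0\<close>
      requires.\<close>
    moreover have "filterlim (\<lambda>n. 1 / real (Suc n)) (at 0) sequentially"
      using LIMSEQ_Suc[OF lim_inverse_n'] by (auto simp: filterlim_at)
    ultimately show "(\<lambda>n. (u (fst p + (1 / real (Suc n)) *\<^sub>R b) (snd p) - u (fst p) (snd p))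
        / (1 / real (Suc n))) \<longlonglongrightarrow> gu (fst p) (snd p) \<bullet> b"
      by (rule filterlim_compose)
  qed
qed

section \<open>Independence as a product rule for integrals\<close>

text \<open>Restricting \<open>M\<close> to the event that \<open>Y\<close> lies in \<open>A\<close>
  and pushing forward along \<open>Z\<close> gives the law of \<open>Z\<close> scaled by the
  probability of that event. Integrating \<open>h\<close> against both measures yields the
  formula.\<close>

lemma indep_rvs_nn_integral:
  assumes "prob_space M" and indep: "indep_rvs M S Y N Z"
    and A: "A \<in> sets S" and h: "h \<in> borel_measurable N"
  shows "(\<integral>\<^sup>+\<omega>. indicator A (Y \<omega>) * h (Z \<omega>) \<partial>M)
    = emeasure M (Y -` A \<inter> space M) * (\<integral>\<^sup>+\<omega>. h (Z \<omega>) \<partial>M)"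
proof -
  interpret prob_space M by fact
  define B where "B = Y -` A \<inter> space M"
  have Y: "Y \<in> M \<rightarrow>\<^sub>M S" and Z[measurable]: "Z \<in> M \<rightarrow>\<^sub>M N"
    and ind: "indep_set {Y -` A \<inter> space M |A. A \<in> sets S} {Z -` B \<inter> space M |B. B \<in> sets N}"
    using indep by (auto simp: indep_rvs_def)
  have B[measurable]: "B \<in> sets M"
    using Y A by (auto simp: B_def)
  note h[measurable]
  have "distr (density M (indicator B)) N Z = scale_measure (emeasure M B) (distr M N Z)"
  proof (rule measure_eqI)
    fix E
    assume "E \<in> sets (distr (density M (indicator B)) N Z)"
    then have E[measurable]: "E \<in> sets N"
      by simp
    have "prob (B \<inter> (Z -` E \<inter> space M)) = prob B * prob (Z -` E \<inter> space M)"
      using A E by (intro indep_setD[OF ind]) (auto simp: B_def)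
    moreover have "emeasure (density M (indicator B)) (Z -` E \<inter> space M)
        = emeasure M (B \<inter> (Z -` E \<inter> space M))"
      by (simp add: emeasure_density flip: indicator_inter_arith)
    ultimately show "emeasure (distr (density M (indicator B)) N Z) E
        = emeasure (scale_measure (emeasure M B) (distr M N Z)) E"
      by (simp add: emeasure_distr emeasure_eq_measure ennreal_mult)
  qed simp
  then have "nn_integral (distr (density M (indicator B)) N Z) h
      = emeasure M B * (\<integral>\<^sup>+\<omega>. h (Z \<omega>) \<partial>M)"
    by (simp add: nn_integral_scale_measure nn_integral_distr)
  moreover have "nn_integral (distr (density M (indicator B)) N Z) h
      = (\<integral>\<^sup>+\<omega>. indicator B \<omega> * h (Z \<omega>) \<partial>M)"
    by (subst nn_integral_distr) (simp_all add: nn_integral_density)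
  moreover have "\<dots> = (\<integral>\<^sup>+\<omega>. indicator A (Y \<omega>) * h (Z \<omega>) \<partial>M)"
    by (intro nn_integral_cong) (simp add: B_def indicator_def)
  ultimately show ?thesis
    by (simp add: B_def)
qed

theorem theorem2:
  fixes f :: "'a::euclidean_space \<Rightarrow> real"
    and gf :: "'a \<Rightarrow> 'a"
    and fs :: "'a \<Rightarrow> 's \<Rightarrow> real"
    and gfs :: "'a \<Rightarrow> 's \<Rightarrow> 'a"
    and D :: "'s measure"
    and r F :: "'a \<Rightarrow> ereal"
    and x0 xmin :: 'a
    and \<sigma> \<Delta> L c \<eta> :: real
    and T :: nat
    and m :: "nat \<Rightarrow> nat"
    and M :: "'\<omega> measure"
    and \<xi> :: "nat \<Rightarrow> nat \<Rightarrow> '\<omega> \<Rightarrow> 's"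
    and X :: "nat \<Rightarrow> '\<omega> \<Rightarrow> 'a"
    and R :: "'\<omega> \<Rightarrow> nat"
  assumes D: "prob_space D"
    and fs_integrable: "\<And>x. integrable D (fs x)"
    and f_expectation: "\<And>x. f x = (\<integral>s. fs x s \<partial>D)"
    and fs_gradient: "\<And>x s. s \<in> space D \<Longrightarrow> GDERIV (\<lambda>y. fs y s) x :> gfs x s"
    and f_gradient: "\<And>x. GDERIV f x :> gf x"
    and r_proper: "proper_fun r"
    and r_lsc: "lsc_fun r"
    and F_def: "\<And>x. F x = ereal (f x) + r x"
    and \<sigma>_pos: "\<sigma> > 0"
    and unbiased: "\<And>x. integrable D (gfs x)" "\<And>x. (\<integral>s. gfs x s \<partial>D) = gf x"
    and variance: "\<And>x. (\<integral>\<^sup>+s. ennreal ((norm (gfs x s - gf x))\<^sup>2) \<partial>D) \<le> ennreal (\<sigma>\<^sup>2)"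
    and xmin: "\<And>x. F xmin \<le> F x"
    and gap: "F x0 - F xmin \<le> ereal \<Delta>"
    and L_pos: "L > 0"
    and Lipschitz: "\<And>x y. norm (gf x - gf y) \<le> L * norm (x - y)"
    and c: "0 < c" "c < 1 / 2"
    and \<eta>: "\<eta> = c / L"
    and prox_nonempty: "\<And>x. prox \<eta> r x \<noteq> {}"
    and T: "T \<ge> 1"
    and m: "\<And>t. t < T \<Longrightarrow> m t \<ge> 1"
    and run: "mb_spg M D gfs r \<eta> T m x0 \<xi> X R"
  shows "(\<integral>\<^sup>+\<omega>. (dist0 (frechet_subdiff F (X (R \<omega>) \<omega>)))\<^sup>2 \<partial>M)
    \<le> ennreal ((2 * c * (1 - 2 * c) + 2) / (c * (1 - 2 * c)) / real T) *
        (\<Sum>t<T. \<integral>\<^sup>+\<omega>. ennreal ((norm (minibatch_grad gfs m \<xi> X t \<omega> - gf (X t \<omega>)))\<^sup>2) \<partial>M)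
      + ennreal ((6 - 4 * c) / (1 - 2 * c) * \<Delta> / (\<eta> * real T))"
proof -
  interpret prob_space M
    using run by (simp add: mb_spg_def)
  define c1 where "c1 = (2 * c * (1 - 2 * c) + 2) / (c * (1 - 2 * c))"
  define c2 where "c2 = (6 - 4 * c) / (1 - 2 * c)"
  have const: "c1 \<ge> 0" "c2 / \<eta> \<ge> 0" "\<eta> > 0"
    using c L_pos by (auto simp: c1_def c2_def \<eta>)
  have X_meas: "X t \<in> borel_measurable M" if "t \<le> T" for t
    using run that by (auto simp: mb_spg_def)
  have X_0: "X 0 \<omega> = x0" if "\<omega> \<in> space M" for \<omega>
    using run that by (auto simp: mb_spg_def)
  have \<xi>_meas: "\<xi> t i \<in> M \<rightarrow>\<^sub>M D" if "t < T" "i < m t" for t i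
    using run that by (auto simp: mb_spg_def)
  have X_Suc: "X (Suc t) \<omega> \<in> prox \<eta> r (X t \<omega> - \<eta> *\<^sub>R minibatch_grad gfs m \<xi> X t \<omega>)"
    if "t < T" "\<omega> \<in> space M" for t \<omega>
    using run that by (auto simp: mb_spg_def)
  have R_meas[measurable]: "R \<in> M \<rightarrow>\<^sub>M count_space UNIV"
    and R_distr: "distr M (count_space UNIV) R = measure_pmf (pmf_of_set {1..T})"
    and R_indep: "indep_rvs M (count_space UNIV) R (history_space D m T) (history m \<xi> X T)"
    using run by (auto simp: mb_spg_def)
  have hist_meas: "history m \<xi> X T \<in> M \<rightarrow>\<^sub>M history_space D m T"
    using R_indep by (simp add: indep_rvs_def)

  \<comment> \<open>Finiteness of the objective along the iterates\<close>
  obtain z where "r z \<noteq> \<infinity>"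
    using r_proper by (auto simp: proper_fun_def)
  then have "F xmin \<noteq> \<infinity>"
    using xmin[of z] by (auto simp: F_def)
  moreover have not_minf: "r x \<noteq> -\<infinity>" for x
    using r_proper by (auto simp: proper_fun_def)
  ultimately have r_xmin: "\<bar>r xmin\<bar> \<noteq> \<infinity>"
    by (auto simp: F_def)
  \<comment> \<open>Otherwise the gap would be infinite and exceed the real
    \<open>\<Delta>\<close>.\<close>
  have r_x0: "r x0 \<noteq> \<infinity>"
    using gap r_xmin by (cases "r xmin") (auto simp: F_def)
  \<comment> \<open>\<open>real_of_ereal\<close> sends \<infinity> to 0, so \<open>Fr\<close>
    represents \<open>F\<close> only where \<open>r\<close> is finite; \<open>r_X\<close> places all
    iterates there.\<close>
  define Fr where "Fr x = f x + real_of_ereal (r x)" for x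
  have F_Fr: "F x = ereal (Fr x)" if "r x \<noteq> \<infinity>" for x
    using not_minf[of x] that by (cases "r x") (auto simp: F_def Fr_def)
  have Fr_gap: "Fr x0 - Fr x \<le> \<Delta>" if "r x \<noteq> \<infinity>" for x
    using gap xmin[of x] r_xmin by (auto simp: F_Fr that r_x0)
  \<comment> \<open>\<open>ennreal\<close> truncates negative reals to 0; this sign later allows
    sums and products to be split.\<close>
  have \<Delta>: "\<Delta> \<ge> 0"
    using Fr_gap[OF r_x0] by simp
  have r_X: "r (X t \<omega>) \<noteq> \<infinity>" if "t \<le> T" "\<omega> \<in> space M" for t \<omega>
  proof (cases t)
    case (Suc s)
    then show ?thesis
      using prox_finite[OF r_proper X_Suc[of s \<omega>]] that by auto
  qed (use that X_0 r_x0 in auto)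

  \<comment> \<open>Bounds for every outcome\<close>
  define G where "G = minibatch_grad gfs m \<xi> X"
  \<comment> \<open>\<open>V t\<close> is the subgradient at iterate \<open>Suc t\<close>, so
    \<open>t < T\<close> covers exactly the output indices from 1 to \<open>T\<close>.\<close>
  define V where "V t \<omega> = gf (X (Suc t) \<omega>) - G t \<omega> - (1 / \<eta>) *\<^sub>R (X (Suc t) \<omega> - X t \<omega>)" for t \<omega>
  have V_subdiff: "V t \<omega> \<in> frechet_subdiff F (X (Suc t) \<omega>)" if "t < T" "\<omega> \<in> space M" for t \<omega>
  proof -
    have "gf (X (Suc t) \<omega>) - (1 / \<eta>) *\<^sub>R (X (Suc t) \<omega> - (X t \<omega> - \<eta> *\<^sub>R G t \<omega>))
        \<in> frechet_subdiff F (X (Suc t) \<omega>)"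
      using prox_frechet_subdiff[OF f_gradient Lipschitz F_def r_proper] X_Suc[OF that]
      by (simp add: G_def)
    then show ?thesis
      using const by (simp add: V_def algebra_simps)
  qed
  have V_step: "(norm (V t \<omega>))\<^sup>2
      \<le> c1 * (norm (G t \<omega> - gf (X t \<omega>)))\<^sup>2 + c2 / \<eta> * (Fr (X t \<omega>) - Fr (X (Suc t) \<omega>))"
    if "t < T" "\<omega> \<in> space M" for t \<omega>
    using prox_gradient_step[OF f_gradient Lipschitz r_proper c L_pos \<eta> X_Suc[OF that] r_X] that
    by (simp add: V_def c1_def c2_def Fr_def G_def)
  have V_sum: "(\<Sum>t<T. (norm (V t \<omega>))\<^sup>2)
      \<le> c1 * (\<Sum>t<T. (norm (G t \<omega> - gf (X t \<omega>)))\<^sup>2) + c2 / \<eta> * \<Delta>"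
    if "\<omega> \<in> space M" for \<omega>
  proof -
    have "(\<Sum>t<T. (norm (V t \<omega>))\<^sup>2)
        \<le> (\<Sum>t<T. c1 * (norm (G t \<omega> - gf (X t \<omega>)))\<^sup>2 + c2 / \<eta> * (Fr (X t \<omega>) - Fr (X (Suc t) \<omega>)))"
      using that by (intro sum_mono V_step) auto
    also have "\<dots> = c1 * (\<Sum>t<T. (norm (G t \<omega> - gf (X t \<omega>)))\<^sup>2)
        + c2 / \<eta> * (\<Sum>t<T. Fr (X t \<omega>) - Fr (X (Suc t) \<omega>))"
      by (simp only: sum.distrib sum_distrib_left)
    also have "(\<Sum>t<T. Fr (X t \<omega>) - Fr (X (Suc t) \<omega>)) = Fr x0 - Fr (X T \<omega>)"
      using sum_lessThan_telescope'[of "\<lambda>t. Fr (X t \<omega>)" T] X_0[OF that] by simp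
    \<comment> \<open>Whatever the last iterate is, its value is at least the minimum, so the
      telescoped decrease is at most \<open>\<Delta>\<close>.\<close>
    also have "c1 * (\<Sum>t<T. (norm (G t \<omega> - gf (X t \<omega>)))\<^sup>2) + c2 / \<eta> * (Fr x0 - Fr (X T \<omega>))
        \<le> c1 * (\<Sum>t<T. (norm (G t \<omega> - gf (X t \<omega>)))\<^sup>2) + c2 / \<eta> * \<Delta>"
      using that const by (intro add_left_mono mult_left_mono Fr_gap r_X) auto
    finally show ?thesis .
  qed

  \<comment> \<open>Measurability as functions of the history\<close>
  have gf_cont: "continuous_on UNIV gf"
    using Lipschitz L_pos by (intro lipschitz_on_continuous_on[of L] lipschitz_onI) (auto simp: dist_norm)
  then have gf_meas[measurable]: "gf \<in> borel_measurable borel"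
    by (rule borel_measurable_continuous_onI)
  have gfs_meas: "(\<lambda>p. gfs (fst p) (snd p)) \<in> borel_measurable (borel \<Otimes>\<^sub>M D)"
    using fs_integrable fs_gradient by (intro borel_measurable_gradient[of fs]) auto

  \<comment> \<open>Independence of \<open>R\<close> is stated relative to
    \<open>history m \<xi> X T\<close>, so \<open>G t\<close> and the squared norm of
    \<open>V t\<close> are rewritten as functions of a history \<open>h\<close>. The history at
    \<open>T\<close> contains iterate \<open>Suc t\<close> for every \<open>t < T\<close>.\<close>
  define H where "H t h = (1 / real (m t)) *\<^sub>R (\<Sum>i<m t. gfs (fst h t) (snd h (t, i)))"
    for t and h :: "(nat \<Rightarrow> 'a) \<times> (nat \<times> nat \<Rightarrow> 's)"
  define W where "W t h = ennreal ((norm (gf (fst h (Suc t)) - H t h - (1 / \<eta>) *\<^sub>R (fst h (Suc t) - fst h t)))\<^sup>2)"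
    for t and h :: "(nat \<Rightarrow> 'a) \<times> (nat \<times> nat \<Rightarrow> 's)"
  have fst_meas: "(\<lambda>h. fst h t) \<in> borel_measurable (history_space D m T)" if "t \<le> T" for t
    using that unfolding history_space_def
    by (intro measurable_compose[OF measurable_fst measurable_component_singleton]) auto
  have snd_meas: "(\<lambda>h. snd h (t, i)) \<in> history_space D m T \<rightarrow>\<^sub>M D" if "t < T" "i < m t" for t i
    using that unfolding history_space_def
    by (intro measurable_compose[OF measurable_snd measurable_component_singleton]) auto
  have H_meas: "H t \<in> borel_measurable (history_space D m T)" if "t < T" for t
  proof -
    have "(\<lambda>h. gfs (fst h t) (snd h (t, i))) \<in> borel_measurable (history_space D m T)"
      if "i < m t" for i
      using measurable_compose[OF measurable_Pair[OF fst_meas snd_meas] gfs_meas] that \<open>t < T\<close>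
      by simp
    then show ?thesis
      unfolding H_def by (intro borel_measurable_scaleR borel_measurable_sum) auto
  qed
  have W_meas: "W t \<in> borel_measurable (history_space D m T)" if "t < T" for t
  proof -
    have "(\<lambda>h. gf (fst h (Suc t)) - H t h - (1 / \<eta>) *\<^sub>R (fst h (Suc t) - fst h t))
        \<in> borel_measurable (history_space D m T)"
      using that by (intro borel_measurable_diff borel_measurable_scaleR borel_measurable_const
          measurable_compose[OF fst_meas gf_meas] H_meas fst_meas) auto
    then show ?thesis
      unfolding W_def by measurable
  qed
  have H_history: "H t (history m \<xi> X T \<omega>) = G t \<omega>" if "t < T" for t \<omega>
    using that by (simp add: H_def G_def minibatch_grad_def history_def)
  have W_history: "W t (history m \<xi> X T \<omega>) = ennreal ((norm (V t \<omega>))\<^sup>2)" if "t < T" for t \<omega>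
    using that H_history[OF that] by (simp add: W_def V_def) (simp add: history_def)
  have G_meas: "G t \<in> borel_measurable M" if "t < T" for t
    using measurable_compose[OF hist_meas H_meas[OF that]] H_history[OF that] by simp
  have V_meas: "(\<lambda>\<omega>. ennreal ((norm (V t \<omega>))\<^sup>2)) \<in> borel_measurable M" if "t < T" for t
    using measurable_compose[OF hist_meas W_meas[OF that]] W_history[OF that] by simp
  have E_meas: "(\<lambda>\<omega>. ennreal ((norm (G t \<omega> - gf (X t \<omega>)))\<^sup>2)) \<in> borel_measurable M" if "t < T" for t
  proof -
    note [measurable] = G_meas[OF that] X_meas[OF less_imp_le[OF that]]
    show ?thesis
      by measurable
  qed

  \<comment> \<open>The law of the output index\<close>
  have R_emeasure: "emeasure M (R -` A \<inter> space M) = emeasure (measure_pmf (pmf_of_set {1..T})) A" for A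
    using emeasure_distr[OF R_meas, of A] R_distr by simp
  have R_point: "emeasure M (R -` {Suc t} \<inter> space M) = ennreal (1 / real T)" if "t < T" for t
    unfolding R_emeasure using that T by (simp add: emeasure_pmf_single pmf_of_set)
  \<comment> \<open>The law fixes the range of \<open>R\<close> only up to a null set, so the
    comparison below holds almost everywhere.\<close>
  have R_range: "AE \<omega> in M. R \<omega> \<in> {1..T}"
  proof -
    have "AE k in distr M (count_space UNIV) R. k \<in> {1..T}"
      unfolding R_distr AE_measure_pmf_iff using T by (subst set_pmf_of_set) auto
    then show ?thesis
      by (subst (asm) AE_distr_iff) auto
  qed

  \<comment> \<open>Passage to expectations\<close>
  have "(\<integral>\<^sup>+\<omega>. (dist0 (frechet_subdiff F (X (R \<omega>) \<omega>)))\<^sup>2 \<partial>M)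
      \<le> (\<integral>\<^sup>+\<omega>. (\<Sum>t<T. indicator {Suc t} (R \<omega>) * W t (history m \<xi> X T \<omega>)) \<partial>M)"
  \<comment> \<open>Monotonicity of \<open>nn_integral\<close> applies to a left integrand of
    unknown measurability. For an outcome with \<open>R\<close> in range, only the indicator with
    \<open>Suc t = R \<omega>\<close> survives on the right.\<close>
  proof (rule nn_integral_mono_AE)
    show "AE \<omega> in M. (dist0 (frechet_subdiff F (X (R \<omega>) \<omega>)))\<^sup>2
        \<le> (\<Sum>t<T. indicator {Suc t} (R \<omega>) * W t (history m \<xi> X T \<omega>))"
      using R_range
    proof (rule AE_mp, intro AE_I2 impI)
      fix \<omega>
      assume \<omega>: "\<omega> \<in> space M" and "R \<omega> \<in> {1..T}"
      then obtain s where s: "R \<omega> = Suc s" "s < T"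
        by (cases "R \<omega>") auto
      have "dist0 (frechet_subdiff F (X (Suc s) \<omega>)) \<le> ennreal (norm (V s \<omega>))"
        unfolding dist0_def using V_subdiff[OF s(2) \<omega>] by (rule INF_lower)
      from power_mono[OF this, of 2]
      have "(dist0 (frechet_subdiff F (X (R \<omega>) \<omega>)))\<^sup>2 \<le> indicator {Suc s} (R \<omega>) * W s (history m \<xi> X T \<omega>)"
        using s by (simp add: W_history ennreal_power)
      also have "\<dots> \<le> (\<Sum>t<T. indicator {Suc t} (R \<omega>) * W t (history m \<xi> X T \<omega>))"
        using s by (intro member_le_sum) auto
      finally show "(dist0 (frechet_subdiff F (X (R \<omega>) \<omega>)))\<^sup>2
          \<le> (\<Sum>t<T. indicator {Suc t} (R \<omega>) * W t (history m \<xi> X T \<omega>))" .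
    qed
  qed
  also have "\<dots> = (\<Sum>t<T. \<integral>\<^sup>+\<omega>. indicator {Suc t} (R \<omega>) * W t (history m \<xi> X T \<omega>) \<partial>M)"
  proof (rule nn_integral_sum)
    fix t
    assume "t \<in> {..<T}"
    then have "W t \<in> borel_measurable (history_space D m T)"
      by (intro W_meas) simp
    then show "(\<lambda>\<omega>. indicator {Suc t} (R \<omega>) * W t (history m \<xi> X T \<omega>)) \<in> borel_measurable M"
      by (intro borel_measurable_times_ennreal measurable_compose[OF hist_meas]
          measurable_compose[OF R_meas]) auto
  qed
  \<comment> \<open>Each summand pairs the event \<open>R = Suc t\<close>, of probability
    \<open>1 / T\<close>, with a function of the history, so the product rule applies.\<close>
  also have "\<dots> = (\<Sum>t<T. ennreal (1 / real T) * (\<integral>\<^sup>+\<omega>. ennreal ((norm (V t \<omega>))\<^sup>2) \<partial>M))"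
    using indep_rvs_nn_integral[OF prob_space_axioms R_indep _ W_meas]
    by (intro sum.cong) (auto simp: R_point W_history)
  also have "\<dots> = ennreal (1 / real T) * (\<integral>\<^sup>+\<omega>. (\<Sum>t<T. ennreal ((norm (V t \<omega>))\<^sup>2)) \<partial>M)"
    using V_meas by (subst nn_integral_sum) (auto simp: sum_distrib_left)
  \<comment> \<open>The decreases have telescoped inside \<open>V_sum\<close> for each outcome, so
    no expectation of \<open>F\<close> at an iterate is ever formed.\<close>
  also have "\<dots> \<le> ennreal (1 / real T) *
      (\<integral>\<^sup>+\<omega>. ennreal c1 * (\<Sum>t<T. ennreal ((norm (G t \<omega> - gf (X t \<omega>)))\<^sup>2)) + ennreal (c2 / \<eta> * \<Delta>) \<partial>M)"
  proof (intro mult_left_mono nn_integral_mono)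
    fix \<omega>
    assume "\<omega> \<in> space M"
    have "ennreal (c1 * S + c2 / \<eta> * \<Delta>) = ennreal c1 * ennreal S + ennreal (c2 / \<eta> * \<Delta>)"
      if "S \<ge> 0" for S
      using const that mult_nonneg_nonneg[OF const(2) \<Delta>]
      by (simp only: ennreal_plus ennreal_mult mult_nonneg_nonneg)
    with ennreal_leI[OF V_sum[OF \<open>\<omega> \<in> space M\<close>]]
    show "(\<Sum>t<T. ennreal ((norm (V t \<omega>))\<^sup>2))
        \<le> ennreal c1 * (\<Sum>t<T. ennreal ((norm (G t \<omega> - gf (X t \<omega>)))\<^sup>2)) + ennreal (c2 / \<eta> * \<Delta>)"
      by (simp add: sum_ennreal sum_nonneg)
  qed simp
  also have "\<dots> = ennreal (1 / real T) *
      (ennreal c1 * (\<Sum>t<T. \<integral>\<^sup>+\<omega>. ennreal ((norm (G t \<omega> - gf (X t \<omega>)))\<^sup>2) \<partial>M) + ennreal (c2 / \<eta> * \<Delta>))"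
  proof -
    have "(\<integral>\<^sup>+\<omega>. (\<Sum>t<T. ennreal ((norm (G t \<omega> - gf (X t \<omega>)))\<^sup>2)) \<partial>M)
        = (\<Sum>t<T. \<integral>\<^sup>+\<omega>. ennreal ((norm (G t \<omega> - gf (X t \<omega>)))\<^sup>2) \<partial>M)"
      using E_meas by (intro nn_integral_sum) simp
    moreover have "(\<lambda>\<omega>. \<Sum>t<T. ennreal ((norm (G t \<omega> - gf (X t \<omega>)))\<^sup>2)) \<in> borel_measurable M"
      using E_meas by (intro borel_measurable_sum) simp
    ultimately show ?thesis
      by (simp add: nn_integral_add nn_integral_cmult emeasure_space_1 del: sum_ennreal)
  qed
  also have "\<dots> = ennreal (c1 / real T) * (\<Sum>t<T. \<integral>\<^sup>+\<omega>. ennreal ((norm (G t \<omega> - gf (X t \<omega>)))\<^sup>2) \<partial>M)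
      + ennreal (c2 * \<Delta> / (\<eta> * real T))"
  proof -
    have "ennreal (1 / real T) * ennreal c1 = ennreal (c1 / real T)"
      using const by (simp flip: ennreal_mult)
    moreover have "ennreal (1 / real T) * ennreal (c2 / \<eta> * \<Delta>) = ennreal (c2 * \<Delta> / (\<eta> * real T))"
      using mult_nonneg_nonneg[OF const(2) \<Delta>] by (subst ennreal_mult[symmetric]) (auto simp: mult.commute)
    ultimately show ?thesis
      by (simp add: distrib_left flip: mult.assoc)
  qed
  finally show ?thesis
    by (simp add: c1_def c2_def G_def)
qed

end
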